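(* For every fixed integer $n\ge0$, the generating polynomial $g_n(y)=\sum_{p\ge0}\mathrm{OCPS}^{(n+1)}(p+1)\,y^p$ of the numbers of order-consecutive partition sequences is $$g_n(y)=\frac{(1+y)^{\frac{n-1}{2}}}{2}\left[\left(\sqrt{1+y}+\sqrt{y}\right)^{n+1}+\left(\sqrt{1+y}-\sqrt{y}\right)^{n+1}\right].$$
   Context: For integers $m,q\ge1$, a partition sequence of $\{1,\dots,m\}$ into $q$ parts is an ordered tuple $(s_1,\dots,s_q)$ of nonempty pairwise disjoint sets with union $\{1,\dots,m\}$. It is order-consecutive if for every $k=1,\dots,q$ the union $\bigcup_{i=1}^k s_i$ is a set of consecutive integers. $\mathrm{OCPS}^{(m)}(q)$ denotes the number of order-consecutive partition sequences of $\{1,\dots,m\}$ into $q$ parts (so it is $0$ for $q>m$, and $g_n$ is a polynomial). The right-hand side is to be read as a polynomial in $y$; equivalently, the identity holds for every complex $y\neq -1$, with any choice of the square roots $\sqrt{1+y}$ and $\sqrt{y}$ and with $(1+y)^{(n-1)/2}:=(\sqrt{1+y})^{\,n-1}$. *)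

theory Defs
  imports Complex_Main "HOL-Computational_Algebra.Polynomial"
begin

text \<open>
  An ordered tuple \<open>(s\<^sub>1, \<dots>, s\<^sub>q)\<close> is represented by a list of length \<open>q\<close>, so the
  part \<open>s\<^sub>i\<close> is the list element \<open>s ! (i - 1)\<close>.
\<close>

definition partition_sequence :: "nat \<Rightarrow> nat \<Rightarrow> nat set list \<Rightarrow> bool" where
  "partition_sequence m q s \<longleftrightarrow>
     length s = q \<and>
     (\<forall>i<q. s ! i \<noteq> {}) \<and>
     (\<forall>i<q. \<forall>j<q. i \<noteq> j \<longrightarrow> s ! i \<inter> s ! j = {}) \<and>
     (\<Union>i<q. s ! i) = {1..m}"

definition consecutive :: "nat set \<Rightarrow> bool" where
  "consecutive S \<longleftrightarrow> (\<exists>a b. S = {a..b})"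

definition order_consecutive :: "nat set list \<Rightarrow> bool" where
  "order_consecutive s \<longleftrightarrow> (\<forall>k\<in>{1..length s}. consecutive (\<Union>i<k. s ! i))"

definition OCPS :: "nat \<Rightarrow> nat \<Rightarrow> nat" where
  "OCPS m q = card {s. partition_sequence m q s \<and> order_consecutive s}"

text \<open>
  The set counted by \<^const>\<open>OCPS\<close> is finite, so its \<^const>\<open>card\<close> is the true number of
  elements.
\<close>

lemma finite_partition_sequences: "finite {s. partition_sequence m q s}"
proof (rule finite_subset)
  show "{s. partition_sequence m q s} \<subseteq> {s. set s \<subseteq> Pow {1..m} \<and> length s = q}"
    unfolding partition_sequence_def by (fastforce simp: in_set_conv_nth)
  show "finite {s. set s \<subseteq> Pow {1..m} \<and> length s = q}"
    by (rule finite_lists_length_eq) simp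
qed

lemma partition_sequence_le:
  assumes "partition_sequence m q s"
  shows "q \<le> m"
proof -
  define f where "f i = (SOME x. x \<in> s ! i)" for i
  have f: "f i \<in> s ! i" if "i < q" for i
    using assms that unfolding partition_sequence_def f_def
    by (metis some_in_eq)
  have "inj_on f {..<q}"
    using f assms unfolding partition_sequence_def inj_on_def by (metis disjoint_iff lessThan_iff)
  moreover have "f ` {..<q} \<subseteq> {1..m}"
    using f assms unfolding partition_sequence_def by blast
  ultimately have "card {..<q} \<le> card {1..m}"
    by (intro card_inj_on_le) auto
  then show ?thesis by simp
qed

lemma OCPS_eq_0: "m < q \<Longrightarrow> OCPS m q = 0"
  unfolding OCPS_def using partition_sequence_le by (fastforce simp: card_eq_0_iff)

text \<open>
  The summation over all \<open>p \<ge> 0\<close> is cut off at \<open>p = n\<close>; no nonzero term is lost, as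
  the coefficient lemma below shows.
\<close>

definition ocps_poly :: "nat \<Rightarrow> complex poly" where
  "ocps_poly n = (\<Sum>p\<le>n. monom (of_nat (OCPS (n + 1) (p + 1))) p)"

lemma coeff_ocps_poly: "coeff (ocps_poly n) p = of_nat (OCPS (n + 1) (p + 1))"
proof -
  have "coeff (ocps_poly n) p = (if p \<le> n then of_nat (OCPS (n + 1) (p + 1)) else 0)"
    unfolding ocps_poly_def by (simp add: coeff_sum)
  then show ?thesis by (simp add: OCPS_eq_0)
qed

end

theory Submission
  imports Defs
begin

text \<open>
  The partial unions of an order-consecutive partition sequence form a strictly increasing
  chain of nonempty intervals ending in \<open>{1..m}\<close>, and they determine the sequence. So one
  can count by the last interval but one: a proper subinterval of size \<open>j\<close> sits in
  \<open>{1..m}\<close> in \<open>m - j + 1\<close> positions, and the chains ending in it are as many as the chains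
  ending in \<open>{1..j}\<close>. Hence for \<open>q \<ge> 1\<close>
  \[ \mathrm{OCPS}^{(m)}(q+1) = \sum_{j=1}^{m-1} (m-j+1)\, \mathrm{OCPS}^{(j)}(q), \]
  which is lemma \<open>OCPS_Suc\<close>. For the generating polynomials this is the convolution
  identity \<open>g\<^sub>n = 1 + y (\<Sum>i<n. (n - i + 1) g\<^sub>i)\<close>.

  The weights \<open>n - i + 1\<close> are linear in \<open>n\<close>, so taking differences twice removes the
  sum and leaves the linear recurrence
  \<open>g\<^sub>n\<^sub>+\<^sub>2 = 2 (1 + y) g\<^sub>n\<^sub>+\<^sub>1 - (1 + y) g\<^sub>n\<close>. With \<open>u\<^sup>2 = 1 + y\<close> and
  \<open>v\<^sup>2 = y\<close>, its characteristic roots are \<open>u (u + v)\<close> and \<open>u (u - v)\<close>: their sum is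
  \<open>2 u\<^sup>2\<close> and their product is \<open>u\<^sup>2 (u\<^sup>2 - v\<^sup>2) = u\<^sup>2\<close>. The closed form is the
  combination of their powers that has the initial values \<open>g\<^sub>0 = 1\<close> and \<open>g\<^sub>1 = 1 + 2y\<close>.
\<close>

section \<open>Order-consecutive sequences on an arbitrary ground set\<close>

text \<open>
  The ground set is arbitrary because dropping the last part of a sequence on \<open>{1..m}\<close>
  leaves a sequence on a subinterval that need not start at 1.
\<close>

definition oc_sequences :: "nat set \<Rightarrow> nat \<Rightarrow> nat set list set" where
  "oc_sequences A q = {s. length s = q \<and>
     (\<forall>i<q. s ! i \<noteq> {}) \<and>
     (\<forall>i<q. \<forall>j<q. i \<noteq> j \<longrightarrow> s ! i \<inter> s ! j = {}) \<and>
     (\<Union>i<q. s ! i) = A \<and> order_consecutive s}"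

lemma OCPS_eq_card_oc_sequences: "OCPS m q = card (oc_sequences {1..<1 + m} q)"
proof -
  have "{1..<1 + m} = {1..m}" by auto
  then show ?thesis
    by (simp add: OCPS_def oc_sequences_def partition_sequence_def conj_assoc)
qed

lemma finite_oc_sequences:
  assumes "finite A"
  shows "finite (oc_sequences A q)"
proof (rule finite_subset)
  show "oc_sequences A q \<subseteq> {s. set s \<subseteq> Pow A \<and> length s = q}"
    unfolding oc_sequences_def by (fastforce simp: in_set_conv_nth)
  show "finite {s. set s \<subseteq> Pow A \<and> length s = q}"
    using assms by (intro finite_lists_length_eq) simp
qed

lemma UN_nth_append_le:
  "k \<le> length t \<Longrightarrow> (\<Union>i<k. (t @ [X]) ! i) = (\<Union>i<k. t ! i)"
  by (intro SUP_cong) (auto simp: nth_append)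

lemma UN_nth_snoc:
  "(\<Union>i<Suc (length t). (t @ [X]) ! i) = (\<Union>i<length t. t ! i) \<union> X"
  by (simp add: lessThan_Suc UN_nth_append_le Un_commute)

lemma order_consecutive_snoc:
  "order_consecutive (t @ [X]) \<longleftrightarrow>
     order_consecutive t \<and> consecutive ((\<Union>i<length t. t ! i) \<union> X)"
proof -
  have "{1..length (t @ [X])} = insert (Suc (length t)) {1..length t}" by auto
  moreover have "consecutive (\<Union>i<k. (t @ [X]) ! i) \<longleftrightarrow> consecutive (\<Union>i<k. t ! i)"
    if "k \<in> {1..length t}" for k
    using that by (simp add: UN_nth_append_le)
  ultimately show ?thesis
    unfolding order_consecutive_def
    by (simp add: UN_nth_snoc UN_nth_append_le) blast
qed

lemma oc_sequences_snoc:
  "t @ [X] \<in> oc_sequences A (Suc q) \<longleftrightarrow>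
     consecutive A \<and> X \<noteq> {} \<and> X \<subseteq> A \<and> t \<in> oc_sequences (A - X) q"
proof (cases "length t = q")
  case True
  have ne: "(\<forall>i<Suc q. (t @ [X]) ! i \<noteq> {}) \<longleftrightarrow> X \<noteq> {} \<and> (\<forall>i<q. t ! i \<noteq> {})"
    using True by (auto simp: nth_append less_Suc_eq)
  have dj: "(\<forall>i<Suc q. \<forall>j<Suc q. i \<noteq> j \<longrightarrow> (t @ [X]) ! i \<inter> (t @ [X]) ! j = {}) \<longleftrightarrow>
      (\<Union>i<q. t ! i) \<inter> X = {} \<and> (\<forall>i<q. \<forall>j<q. i \<noteq> j \<longrightarrow> t ! i \<inter> t ! j = {})"
    using True by (auto simp: All_less_Suc nth_append Int_UN_distrib2 Int_commute) blast
  have un: "(\<Union>i<Suc q. (t @ [X]) ! i) = (\<Union>i<q. t ! i) \<union> X"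
    using UN_nth_snoc[of t X] True by simp
  have "(\<Union>i<q. t ! i) \<inter> X = {} \<and> (\<Union>i<q. t ! i) \<union> X = A \<longleftrightarrow>
      X \<subseteq> A \<and> (\<Union>i<q. t ! i) = A - X"
    by blast
  then show ?thesis
    unfolding oc_sequences_def mem_Collect_eq ne dj un order_consecutive_snoc
    using True by auto
qed (simp add: oc_sequences_def)

lemma oc_sequences_ground_unique:
  "s \<in> oc_sequences A q \<Longrightarrow> s \<in> oc_sequences B q \<Longrightarrow> A = B"
  by (simp add: oc_sequences_def)

lemma oc_sequences_ground_interval:
  assumes "s \<in> oc_sequences A q" "q > 0"
  shows "A \<noteq> {} \<and> consecutive A"
proof -
  have "(\<Union>i<length s. s ! i) = A" "s ! 0 \<noteq> {}" "order_consecutive s" "length s = q"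
    using assms by (auto simp: oc_sequences_def)
  then show ?thesis
    using assms(2) unfolding order_consecutive_def by fastforce
qed

section \<open>Counting by the last interval but one\<close>

lemma consecutive_atLeastLessThan: "consecutive {a..<a + m}"
proof (cases m)
  case 0
  then show ?thesis unfolding consecutive_def by (intro exI[of _ 1] exI[of _ 0]) simp
next
  case (Suc l)
  then have "{a..<a + m} = {a..a + l}" by auto
  then show ?thesis unfolding consecutive_def by blast
qed

text \<open>
  The size \<open>j\<close> ranges first because the number of sequences on \<open>{c..<c + j}\<close> will turn out
  to be independent of the position \<open>c\<close>.
\<close>

lemma proper_subintervals:
  "{B. B \<noteq> {} \<and> consecutive B \<and> B \<subset> {a..<a + m}} =
     (\<lambda>(j, c). {c..<c + j}) ` (SIGMA j:{1..<m}. {a..a + m - j})"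
proof (intro equalityI subsetI)
  fix B assume "B \<in> {B. B \<noteq> {} \<and> consecutive B \<and> B \<subset> {a..<a + m}}"
  then obtain c d where B: "B = {c..d}" "B \<noteq> {}" "B \<subset> {a..<a + m}"
    unfolding consecutive_def by blast
  then have cd: "c \<le> d" by simp
  have "{c, d} \<subseteq> B" using B(1) cd by simp
  then have "c \<in> {a..<a + m}" "d \<in> {a..<a + m}" using B(3) by blast+
  moreover have "Suc d - c < m"
    using psubset_card_mono[OF _ B(3)] B(1) by simp
  moreover have "B = {c..<c + (Suc d - c)}" using B by auto
  ultimately show "B \<in> (\<lambda>(j, c). {c..<c + j}) ` (SIGMA j:{1..<m}. {a..a + m - j})"
    using cd by (intro image_eqI[of _ _ "(Suc d - c, c)"]) auto
next
  fix B assume "B \<in> (\<lambda>(j, c). {c..<c + j}) ` (SIGMA j:{1..<m}. {a..a + m - j})"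
  then obtain j c where jc: "B = {c..<c + j}" "1 \<le> j" "j < m" "a \<le> c" "c \<le> a + m - j"
    by auto
  have "card B < card {a..<a + m}" using jc by simp
  then have "B \<noteq> {a..<a + m}" by blast
  then show "B \<in> {B. B \<noteq> {} \<and> consecutive B \<and> B \<subset> {a..<a + m}}"
    using jc consecutive_atLeastLessThan by auto
qed

text \<open>
  Splitting by the union \<open>B\<close> of all parts but the last, which is a proper subinterval; the
  last part is then forced to be the complement of \<open>B\<close>. The hypothesis \<open>q > 0\<close> makes \<open>B\<close>
  nonempty.
\<close>

lemma card_oc_sequences_Suc:
  assumes "q > 0"
  shows "card (oc_sequences {a..<a + m} (Suc q)) =
    (\<Sum>j=1..<m. \<Sum>c=a..a + m - j. card (oc_sequences {c..<c + j} q))"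
proof -
  define A where "A = {a..<a + m}"
  define \<B> where "\<B> = {B. B \<noteq> {} \<and> consecutive B \<and> B \<subset> A}"
  define I where "I = (SIGMA j:{1..<m}. {a..a + m - j})"
  have \<B>_I: "\<B> = (\<lambda>(j, c). {c..<c + j}) ` I"
    unfolding \<B>_def A_def I_def by (rule proper_subintervals)
  have inj: "inj_on (\<lambda>(j, c). {c..<c + j}) I"
    unfolding I_def by (rule inj_onI) (clarsimp simp: atLeastLessThan_eq_iff)
  have split: "oc_sequences A (Suc q) = (\<Union>B\<in>\<B>. (\<lambda>t. t @ [A - B]) ` oc_sequences B q)"
  proof (intro equalityI subsetI)
    fix s assume s: "s \<in> oc_sequences A (Suc q)"
    then have "length s = Suc q" by (simp add: oc_sequences_def)
    then obtain t X where tX: "s = t @ [X]" by (auto simp: length_Suc_conv_rev)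
    with s have t: "t \<in> oc_sequences (A - X) q" "X \<noteq> {}" "X \<subseteq> A"
      by (auto simp: oc_sequences_snoc)
    then have "A - X \<in> \<B>"
      using oc_sequences_ground_interval[OF t(1) assms] unfolding \<B>_def by auto
    moreover have "s = t @ [A - (A - X)]" using tX t(3) by (simp add: double_diff)
    ultimately show "s \<in> (\<Union>B\<in>\<B>. (\<lambda>t. t @ [A - B]) ` oc_sequences B q)"
      using t(1) by blast
  next
    fix s assume "s \<in> (\<Union>B\<in>\<B>. (\<lambda>t. t @ [A - B]) ` oc_sequences B q)"
    then obtain B t where B: "B \<in> \<B>" "t \<in> oc_sequences B q" "s = t @ [A - B]" by blast
    then have "A - (A - B) = B" "A - B \<noteq> {}" unfolding \<B>_def by auto
    with B show "s \<in> oc_sequences A (Suc q)"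
      by (simp add: oc_sequences_snoc A_def consecutive_atLeastLessThan)
  qed
  have finI: "finite I" unfolding I_def by simp
  have fin: "finite B" if "B \<in> \<B>" for B
    using that unfolding \<B>_def A_def by (auto intro: finite_subset)
  have "card (oc_sequences A (Suc q)) =
      (\<Sum>B\<in>\<B>. card ((\<lambda>t. t @ [A - B]) ` oc_sequences B q))"
    unfolding split
  proof (rule card_UN_disjoint)
    show "finite \<B>" using finI \<B>_I by simp
    show "\<forall>B\<in>\<B>. finite ((\<lambda>t. t @ [A - B]) ` oc_sequences B q)"
      using fin finite_oc_sequences by blast
    show "\<forall>B\<in>\<B>. \<forall>C\<in>\<B>. B \<noteq> C \<longrightarrow>
        (\<lambda>t. t @ [A - B]) ` oc_sequences B q \<inter> (\<lambda>t. t @ [A - C]) ` oc_sequences C q = {}"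
      by (auto dest: oc_sequences_ground_unique)
  qed
  also have "\<dots> = (\<Sum>B\<in>\<B>. card (oc_sequences B q))"
    by (intro sum.cong card_image inj_onI) auto
  also have "\<dots> = (\<Sum>(j, c)\<in>I. card (oc_sequences {c..<c + j} q))"
    unfolding \<B>_I by (subst sum.reindex[OF inj]) (simp add: case_prod_unfold)
  also have "\<dots> = (\<Sum>j=1..<m. \<Sum>c=a..a + m - j. card (oc_sequences {c..<c + j} q))"
    unfolding I_def by (subst sum.Sigma) auto
  finally show ?thesis unfolding A_def .
qed

lemma oc_sequences_1:
  assumes "m > 0"
  shows "oc_sequences {a..<a + m} 1 = {[{a..<a + m}]}"
proof -
  have "s \<in> oc_sequences {a..<a + m} 1 \<longleftrightarrow> s = [{a..<a + m}]" for s
  proof (cases "length s = 1")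
    case True
    then obtain X where "s = [X]" by (auto simp: length_Suc_conv)
    then show ?thesis
      using assms consecutive_atLeastLessThan[of a m]
      by (auto simp: oc_sequences_def order_consecutive_def)
  qed (auto simp: oc_sequences_def)
  then show ?thesis by blast
qed

text \<open>
  Both sides satisfy the same recursion in \<open>q\<close>, so no explicit shift of the sequences is
  needed.
\<close>

lemma card_oc_sequences_translate:
  assumes "q > 0" "m > 0"
  shows "card (oc_sequences {a..<a + m} q) = OCPS m q"
  using assms
proof (induction q arbitrary: a m rule: nat_induct_non_zero)
  case 1
  then show ?case
    by (simp only: OCPS_eq_card_oc_sequences oc_sequences_1) simp
next
  case (Suc q)
  have *: "card (oc_sequences {a..<a + m} (Suc q)) =
      (\<Sum>j=1..<m. (m - j + 1) * OCPS j q)" for a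
    unfolding card_oc_sequences_Suc[OF \<open>q > 0\<close>]
    by (intro sum.cong) (simp_all add: Suc.IH Suc_diff_le)
  show ?case
    unfolding OCPS_eq_card_oc_sequences * ..
qed

lemma OCPS_Suc:
  assumes "q > 0"
  shows "OCPS m (Suc q) = (\<Sum>j=1..<m. (m - j + 1) * OCPS j q)"
  unfolding OCPS_eq_card_oc_sequences[of m] card_oc_sequences_Suc[OF assms]
  by (intro sum.cong) (simp_all add: card_oc_sequences_translate assms Suc_diff_le)

lemma OCPS_1: "m > 0 \<Longrightarrow> OCPS m 1 = 1"
  by (simp only: OCPS_eq_card_oc_sequences oc_sequences_1) simp

section \<open>The linear recurrence of the generating polynomials\<close>

lemma poly_ocps_poly:
  assumes "n \<le> N"
  shows "poly (ocps_poly n) y = (\<Sum>p\<le>N. of_nat (OCPS (n + 1) (p + 1)) * y ^ p)"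
proof -
  have "poly (ocps_poly n) y = (\<Sum>p\<le>n. of_nat (OCPS (n + 1) (p + 1)) * y ^ p)"
    by (simp add: ocps_poly_def poly_sum poly_monom)
  also have "\<dots> = (\<Sum>p\<le>N. of_nat (OCPS (n + 1) (p + 1)) * y ^ p)"
    using assms by (intro sum.mono_neutral_left) (auto simp: OCPS_eq_0)
  finally show ?thesis .
qed

lemma ocps_poly_convolution:
  "poly (ocps_poly n) y = 1 + y * (\<Sum>i<n. of_nat (n - i + 1) * poly (ocps_poly i) y)"
proof -
  have rec: "OCPS (n + 1) (p + 2) = (\<Sum>i<n. (n - i + 1) * OCPS (i + 1) (p + 1))" for p
  proof -
    have "OCPS (n + 1) (p + 2) = (\<Sum>j=1..<n + 1. (n + 1 - j + 1) * OCPS j (p + 1))"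
      using OCPS_Suc[of "p + 1" "n + 1"] by simp
    also have "\<dots> = (\<Sum>i<n. (n - i + 1) * OCPS (i + 1) (p + 1))"
      using sum.shift_bounds_nat_ivl[of "\<lambda>j. (n + 1 - j + 1) * OCPS j (p + 1)" 0 1 n]
      by (simp add: lessThan_atLeast0)
    finally show ?thesis .
  qed
  \<comment> \<open>Summing one degree too far, up to \<open>n + 1\<close>, leaves the range \<open>p \<le> n\<close> after the
    constant term is split off; this range covers every \<open>g\<^sub>i\<close> with \<open>i < n\<close>.\<close>
  have "poly (ocps_poly n) y = (\<Sum>p\<le>Suc n. of_nat (OCPS (n + 1) (p + 1)) * y ^ p)"
    by (rule poly_ocps_poly) simp
  also have "\<dots> = 1 + (\<Sum>p\<le>n. of_nat (OCPS (n + 1) (p + 2)) * y ^ (p + 1))"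
    using OCPS_1[of "n + 1"] by (subst sum.atMost_Suc_shift) simp
  also have "\<dots> = 1 + (\<Sum>p\<le>n. \<Sum>i<n. y * (of_nat (n - i + 1) *
      (of_nat (OCPS (i + 1) (p + 1)) * y ^ p)))"
    unfolding rec of_nat_sum of_nat_mult sum_distrib_right
    by (simp add: mult_ac)
  also have "\<dots> = 1 + y * (\<Sum>i<n. of_nat (n - i + 1) *
      (\<Sum>p\<le>n. of_nat (OCPS (i + 1) (p + 1)) * y ^ p))"
    by (subst sum.swap) (simp only: sum_distrib_left)
  also have "\<dots> = 1 + y * (\<Sum>i<n. of_nat (n - i + 1) * poly (ocps_poly i) y)"
    by (simp add: poly_ocps_poly[of _ n])
  finally show ?thesis .
qed

lemma ocps_poly_Suc:
  "poly (ocps_poly (Suc n)) y =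
     (1 + 2 * y) * poly (ocps_poly n) y + y * (\<Sum>i<n. poly (ocps_poly i) y)"
proof -
  have "(\<Sum>i<n. of_nat (Suc n - i + 1) * poly (ocps_poly i) y) =
      (\<Sum>i<n. of_nat (n - i + 1) * poly (ocps_poly i) y) + (\<Sum>i<n. poly (ocps_poly i) y)"
    unfolding sum.distrib[symmetric]
    by (intro sum.cong) (simp_all add: Suc_diff_le algebra_simps)
  then have "poly (ocps_poly (Suc n)) y =
      1 + y * (\<Sum>i<n. of_nat (n - i + 1) * poly (ocps_poly i) y)
        + y * (\<Sum>i<n. poly (ocps_poly i) y) + 2 * y * poly (ocps_poly n) y"
    unfolding ocps_poly_convolution[of "Suc n"] sum.lessThan_Suc
    by (simp add: algebra_simps)
  then show ?thesis
    unfolding ocps_poly_convolution[of n, symmetric] by (simp add: algebra_simps)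
qed

lemma ocps_poly_0: "poly (ocps_poly 0) y = 1"
  by (subst ocps_poly_convolution) simp

lemma ocps_poly_1: "poly (ocps_poly (Suc 0)) y = 1 + 2 * y"
  by (simp add: ocps_poly_Suc ocps_poly_0)

lemma ocps_poly_Suc_Suc:
  "poly (ocps_poly (Suc (Suc n))) y =
     2 * (1 + y) * poly (ocps_poly (Suc n)) y - (1 + y) * poly (ocps_poly n) y"
  using ocps_poly_Suc[of "Suc n" y] ocps_poly_Suc[of n y] by (simp add: algebra_simps)

section \<open>The closed form\<close>

text \<open>
  Writing the closed form with the characteristic roots \<open>u (u \<plusminus> v)\<close> turns it into a sum of
  geometric sequences; the factor \<open>2 u\<^sup>2\<close> avoids the negative power of \<open>u\<close> at \<open>n = 0\<close>.
\<close>

lemma ocps_poly_closed_form: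
  fixes u v y :: complex
  assumes "u ^ 2 = 1 + y" "v ^ 2 = y"
  shows "2 * u ^ 2 * poly (ocps_poly n) y =
    (u * (u + v)) ^ (n + 1) + (u * (u - v)) ^ (n + 1)"
proof (induction n rule: induct_nat_012)
  case 0
  then show ?case by (simp add: ocps_poly_0 power2_eq_square algebra_simps)
next
  case 1
  then show ?case
    using assms by (simp add: ocps_poly_1 power2_eq_square) algebra
next
  case (ge2 n)
  define r s where "r = u * (u + v)" and "s = u * (u - v)"
  have sum: "r + s = 2 * (1 + y)" and prod: "r * s = 1 + y"
    unfolding r_def s_def using assms by algebra+
  have "2 * u ^ 2 * poly (ocps_poly (Suc (Suc n))) y =
      (r + s) * (2 * u ^ 2 * poly (ocps_poly (Suc n)) y)
        - r * s * (2 * u ^ 2 * poly (ocps_poly n) y)"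
    unfolding ocps_poly_Suc_Suc sum prod by (simp add: algebra_simps)
  also have "\<dots> = (r + s) * (r ^ (n + 2) + s ^ (n + 2))
      - r * s * (r ^ (n + 1) + s ^ (n + 1))"
    unfolding ge2.IH r_def s_def by simp
  also have "\<dots> = r ^ (n + 3) + s ^ (n + 3)"
    by (simp add: algebra_simps power_add numeral_3_eq_3)
  finally show ?case by (simp add: r_def s_def numeral_3_eq_3)
qed

theorem proposition4p4:
  fixes n :: nat and y u v :: complex
  assumes "y \<noteq> -1"
    and "u ^ 2 = 1 + y"
    and "v ^ 2 = y"
  shows "poly (ocps_poly n) y =
    u powi (int n - 1) / 2 * ((u + v) ^ (n + 1) + (u - v) ^ (n + 1))"
proof -
  have u: "u \<noteq> 0" using assms(1,2) by (auto simp: add_eq_0_iff)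
  have pow: "u powi (int n - 1) = u ^ (n + 1) / u ^ 2"
    using u by (simp add: power_int_diff power2_eq_square)
  have "poly (ocps_poly n) y =
      ((u * (u + v)) ^ (n + 1) + (u * (u - v)) ^ (n + 1)) / (2 * u ^ 2)"
    using ocps_poly_closed_form[OF assms(2,3), of n] u by (simp add: field_simps)
  also have "\<dots> = u powi (int n - 1) / 2 * ((u + v) ^ (n + 1) + (u - v) ^ (n + 1))"
    unfolding pow power_mult_distrib using u by (simp add: divide_simps distrib_left)
  finally show ?thesis .
qed

end
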